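(* Let $G=(V,E)$ be a finite undirected graph with $n$ vertices, and let $k\ge 2$ be an integer with $\lfloor k/2\rfloor\le n$, such that every odd cycle in $G$ has length greater than $2k+1$. Then there is a set $X\subseteq V$ with $$|X|\le \frac{n}{\lfloor k/2\rfloor}\ln\frac{n}{\lfloor k/2\rfloor}$$ such that the graph obtained from $G$ by deleting the vertices of $X$ is bipartite. *)

theory Defs
  imports Complex_Main "Graph_Theory.Graph_Theory"
begin

(* Finite simple undirected graphs are the symmetric loop-free digraphs without parallel arcs
   of the locale graph: each undirected edge is a pair of opposite arcs.  Such a pair forms a
   directed cycle a, b, a that is not an undirected cycle, but it has even length; as there are
   no loops, the odd directed cycles are exactly the (rooted, oriented) odd undirected cycles. *)

definition bipartite :: "('a, 'b) pre_digraph \<Rightarrow> bool" where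
  "bipartite G \<longleftrightarrow> (\<exists>A B. verts G = A \<union> B \<and> A \<inter> B = {} \<and>
     (\<forall>e \<in> arcs G. (tail G e \<in> A \<and> head G e \<in> B) \<or> (tail G e \<in> B \<and> head G e \<in> A)))"

end

theory Submission
  imports Defs
begin

text \<open>
  Put \<open>m = \<lfloor>k/2\<rfloor>\<close> and \<open>L = ln (n/m) / m\<close>. Grow balls \<open>B\<^sub>0 \<subseteq> B\<^sub>1 \<subseteq> \<dots>\<close> around a vertex of the
  current graph. Either they become stationary within \<open>m\<close> steps, or \<open>|B\<^sub>m| \<ge> m\<close>; in the latter case
  one of the next \<open>m\<close> spheres satisfies \<open>|S\<^sub>r| \<le> L |B\<^sub>r|\<close>, since otherwise
  \<open>|B\<^sub>2\<^sub>m| > exp (L m) |B\<^sub>m| \<ge> n\<close>. Deleting that sphere separates the ball \<open>B\<^sub>r\<^sub>-\<^sub>1\<close>, of radius less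
  than \<open>k\<close>, which is properly 2-coloured by the parity of the distance to its centre because an arc
  inside one distance class would close an odd walk of length less than \<open>2k\<close>. Iterating on the
  vertices outside \<open>B\<^sub>r\<close> deletes at most \<open>L n\<close> vertices in total.
\<close>

text \<open>At a repeated vertex the walk splits into an inner closed walk and a remaining one.
  Their lengths add up to an odd number, so one of them is odd and shorter, and induction applies to
  it.\<close>

lemma (in wf_digraph) odd_closed_awalk_contains_odd_cycle:
  assumes "awalk u p u" "odd (length p)"
  shows "\<exists>c. cycle c \<and> odd (length c) \<and> length c \<le> length p"
  using assms
proof (induction "length p" arbitrary: u p rule: less_induct)
  case less
  then obtain e es where p: "p = e # es" by (cases p) auto
  with less.prems have e: "e \<in> arcs G" "tail G e = u" and es: "awalk (head G e) es u"
    by (auto simp: awalk_Cons_iff)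
  show ?case
  \<comment> \<open>The start vertex is left out, since a closed walk returns to it at the
    end.\<close>
  proof (cases "distinct (awalk_verts (head G e) es)")
    case True
    with p less.prems have "cycle p"
      unfolding cycle_def by (intro exI[of _ u]) simp
    with less.prems show ?thesis by blast
  next
    case False
    from awalk_not_distinct_decomp[OF es False] obtain q r s w where
      dec: "es = q @ r @ s" "0 < length r" "awalk (head G e) q w" "awalk w r w" "awalk w s u"
      by blast
    have rest: "awalk u (e # q @ s) u"
      using e dec by (auto simp: awalk_Cons_iff intro: awalk_appendI)
    show ?thesis
    proof (cases "odd (length r)")
      case True
      with less.hyps[of r w] dec p obtain c where "cycle c" "odd (length c)" "length c \<le> length r"
        by auto
      with dec p show ?thesis by (intro exI[of _ c]) auto
    next
      case False
      with less.prems p dec have "odd (length (e # q @ s))" by auto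
      with less.hyps[OF _ rest] dec p obtain c
        where "cycle c" "odd (length c)" "length c \<le> length (e # q @ s)" by auto
      with dec p show ?thesis by (intro exI[of _ c]) auto
    qed
  qed
qed

context pre_digraph
begin

text \<open>For \<open>v\<close> in \<open>W\<close> these are the balls of the subgraph induced on
  \<open>W\<close>. Only \<open>W\<close> shrinks during the iteration while \<open>G\<close> stays
  fixed, so the hypothesis on odd cycles never has to be transferred to a subgraph.\<close>

primrec ball_in :: "'a set \<Rightarrow> 'a \<Rightarrow> nat \<Rightarrow> 'a set" where
  "ball_in W v 0 = {v}"
| "ball_in W v (Suc r) =
     ball_in W v r \<union> {w \<in> W. \<exists>e \<in> arcs G. tail G e \<in> ball_in W v r \<and> head G e = w}"

text \<open>This is the distance from \<open>v\<close> inside \<open>W\<close>, meaningful only for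
  vertices lying in some ball.\<close>

definition level_in :: "'a set \<Rightarrow> 'a \<Rightarrow> 'a \<Rightarrow> nat" where
  "level_in W v w = (LEAST i. w \<in> ball_in W v i)"

lemma ball_in_subset: "v \<in> W \<Longrightarrow> ball_in W v r \<subseteq> W"
  by (induction r) auto

lemma level_in_le: "w \<in> ball_in W v r \<Longrightarrow> level_in W v w \<le> r"
  unfolding level_in_def by (rule Least_le)

lemma in_ball_level_in: "w \<in> ball_in W v r \<Longrightarrow> w \<in> ball_in W v (level_in W v w)"
  unfolding level_in_def by (rule LeastI)

lemma level_in_head_le:
  assumes "e \<in> arcs G" "tail G e \<in> ball_in W v r" "head G e \<in> W"
  shows "level_in W v (head G e) \<le> Suc (level_in W v (tail G e))"
  using assms in_ball_level_in[OF assms(2)] by (intro level_in_le) auto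

end

lemma (in sym_digraph) ex_reverse_arc:
  assumes "e \<in> arcs G"
  obtains e' where "e' \<in> arcs G" "tail G e' = head G e" "head G e' = tail G e"
  using sym_arcs assms unfolding symmetric_conv by metis

text \<open>Arcs are directed, so the way out and the way back are built together, from an arc and
  its reverse at each step. Both are needed to close a walk through \<open>v\<close>.\<close>

lemma (in sym_digraph) ball_in_awalks_of_level_length:
  assumes "v \<in> W" "W \<subseteq> verts G" "w \<in> ball_in W v r"
  shows "\<exists>p q. awalk v p w \<and> awalk w q v \<and>
    length p = level_in W v w \<and> length q = level_in W v w"
  using assms(3)
proof (induction "level_in W v w" arbitrary: w r)
  case 0
  with in_ball_level_in[OF 0(2)] have "w = v" by simp
  with 0 assms show ?case by (intro exI[of _ "[]"]) (auto simp: awalk_Nil_iff)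
next
  case (Suc i)
  have "w \<in> ball_in W v (Suc i)" using in_ball_level_in[OF Suc.prems] Suc.hyps(2) by simp
  moreover have "w \<notin> ball_in W v i" using level_in_le[of w W v i] Suc.hyps(2) by auto
  ultimately obtain e where e: "e \<in> arcs G" "tail G e \<in> ball_in W v i" "head G e = w" "w \<in> W"
    by auto
  \<comment> \<open>A smaller level of the tail would give \<open>w\<close> a level below
    \<open>Suc i\<close>.\<close>
  have lev: "level_in W v (tail G e) = i"
    using level_in_head_le[OF e(1,2), of] level_in_le[OF e(2)] e Suc.hyps(2) by simp
  from Suc.hyps(1)[OF lev[symmetric] e(2)] lev obtain p q where
    pq: "awalk v p (tail G e)" "awalk (tail G e) q v" "length p = i" "length q = i" by auto
  obtain e' where e': "e' \<in> arcs G" "tail G e' = head G e" "head G e' = tail G e"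
    using ex_reverse_arc[OF e(1)] .
  have "awalk v (p @ [e]) w"
    using pq e by (auto intro!: awalk_appendI simp: awalk_Cons_iff awalk_Nil_iff)
  moreover have "awalk w (e' # q) v" using pq e e' by (auto simp: awalk_Cons_iff)
  ultimately show ?case using pq Suc.hyps(2)
    by (intro exI[of _ "p @ [e]"] exI[of _ "e' # q"]) auto
qed

text \<open>Levels of adjacent vertices differ by at most one, so equal parity means a common level
  \<open>d \<le> r\<close>. Going out, across the arc and back is then an odd closed walk of length
  \<open>2 * d + 1\<close>, which contains a forbidden odd cycle.\<close>

lemma (in sym_digraph) level_in_parity_alternates:
  assumes "v \<in> W" "W \<subseteq> verts G"
    and girth: "\<And>c. cycle c \<Longrightarrow> odd (length c) \<Longrightarrow> length c > 2 * r + 1"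
    and e: "e \<in> arcs G" "tail G e \<in> ball_in W v r" "head G e \<in> ball_in W v r"
  shows "even (level_in W v (tail G e)) \<noteq> even (level_in W v (head G e))"
proof
  assume par: "even (level_in W v (tail G e)) = even (level_in W v (head G e))"
  obtain e' where e': "e' \<in> arcs G" "tail G e' = head G e" "head G e' = tail G e"
    using ex_reverse_arc[OF e(1)] .
  have inW: "tail G e \<in> W" "head G e \<in> W" using e ball_in_subset[OF assms(1)] by blast+
  have "level_in W v (head G e) \<le> Suc (level_in W v (tail G e))"
    using level_in_head_le e inW by blast
  moreover have "level_in W v (tail G e) \<le> Suc (level_in W v (head G e))"
    using level_in_head_le[of e'] e' e inW by metis
  ultimately have eq: "level_in W v (tail G e) = level_in W v (head G e)"
    using par by (metis even_Suc le_SucE le_antisym)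
  obtain p where p: "awalk v p (tail G e)" "length p = level_in W v (tail G e)"
    using ball_in_awalks_of_level_length[OF assms(1,2) e(2)] by blast
  obtain q where q: "awalk (head G e) q v" "length q = level_in W v (head G e)"
    using ball_in_awalks_of_level_length[OF assms(1,2) e(3)] by blast
  have "awalk v (p @ e # q) v"
    using p q e by (auto intro!: awalk_appendI simp: awalk_Cons_iff)
  moreover have "odd (length (p @ e # q))" using p q eq by simp
  ultimately obtain c where c: "cycle c" "odd (length c)" "length c \<le> length (p @ e # q)"
    using odd_closed_awalk_contains_odd_cycle by blast
  have "length (p @ e # q) \<le> 2 * r + 1" using p q eq level_in_le[OF e(2)] by simp
  with girth[OF c(1,2)] c(3) show False by simp
qed

text \<open>Since \<open>1 - L \<le> exp (-L)\<close>, each failing step multiplies the size by more than \<open>exp L\<close>.\<close>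

lemma small_sphere_exists:
  fixes B :: "nat \<Rightarrow> 'a set" and m n :: nat
  assumes m: "m \<ge> 1" "m \<le> n"
    and fin: "\<And>r. finite (B r)" and B0: "B 0 \<noteq> {}" and mono: "\<And>r. B r \<subseteq> B (Suc r)"
    and le: "\<And>r. card (B r) \<le> n"
  defines "L \<equiv> ln (real n / real m) / real m"
  shows "\<exists>r < 2 * m. real (card (B (Suc r) - B r)) \<le> L * real (card (B (Suc r)))"
proof (rule ccontr)
  assume "\<not> ?thesis"
  then have big: "L * real (card (B (Suc r))) < real (card (B (Suc r) - B r))" if "r < 2 * m" for r
    using that by (meson not_le)
  have L0: "L \<ge> 0" unfolding L_def using m by (auto intro!: divide_nonneg_nonneg ln_ge_zero)
  have diff: "card (B (Suc r) - B r) + card (B r) = card (B (Suc r))" for r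
    using card_mono[OF fin mono, of r] by (simp add: card_Diff_subset[OF fin mono])
  \<comment> \<open>As \<open>L \<ge> 0\<close>, a failing sphere is nonempty, so each step adds a
    vertex. A stationary ball has an empty sphere and hence needs no separate case.\<close>
  have start: "Suc r \<le> card (B r)" if "r \<le> 2 * m" for r
    using that
  proof (induction r)
    case 0
    then show ?case using B0 fin by (simp add: Suc_le_eq card_gt_0_iff)
  next
    case (Suc r)
    have "0 \<le> L * real (card (B (Suc r)))" using L0 by simp
    then have "0 < real (card (B (Suc r) - B r))" using big[of r] Suc.prems by linarith
    then show ?case using diff[of r] Suc by simp
  qed
  have step: "exp L * real (card (B r)) \<le> real (card (B (Suc r)))" if "r < 2 * m" for r
  proof -
    have "real (card (B r)) \<le> (1 - L) * real (card (B (Suc r)))"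
      using big[OF that] diff[of r, THEN arg_cong[where f = real]]
      by (simp add: algebra_simps)
    also have "\<dots> \<le> exp (- L) * real (card (B (Suc r)))"
      using exp_ge_add_one_self[of "- L"] by (intro mult_right_mono) auto
    finally show ?thesis by (simp add: exp_minus field_simps)
  qed
  have grow: "exp L ^ j * real (card (B m)) \<le> real (card (B (m + j)))" if "j \<le> m" for j
    using that
  proof (induction j)
    case (Suc j)
    have "exp L ^ Suc j * real (card (B m)) = exp L * (exp L ^ j * real (card (B m)))" by simp
    also have "\<dots> \<le> exp L * real (card (B (m + j)))" using Suc by (intro mult_left_mono) auto
    also have "\<dots> \<le> real (card (B (m + Suc j)))" using step[of "m + j"] Suc by simp
    finally show ?case .
  qed simp
  \<comment> \<open>This fixes the choice of \<open>L\<close>: \<open>m\<close> growth steps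
    multiply the size by exactly \<open>n / m\<close>.\<close>
  have "exp L ^ m = exp (real m * L)" by (simp add: exp_of_nat_mult)
  also have "real m * L = ln (real n / real m)" using m by (simp add: L_def)
  also have "exp \<dots> = real n / real m" using m by simp
  finally have "real n / real m * real (card (B m)) \<le> real (card (B (m + m)))"
    using grow[of m] by simp
  also have "\<dots> \<le> real n" using le by simp
  finally have "real n * real (card (B m)) \<le> real n * real m"
    using m by (simp add: field_simps)
  \<comment> \<open>The centre makes the count in \<open>start\<close> one larger than the radius,
    which suffices for the contradiction.\<close>
  then have "card (B m) \<le> m" using m by simp
  with start[of m] show False by simp
qed

text \<open>The ratio \<open>L\<close> depends on the fixed \<open>n\<close>, not on
  \<open>card W\<close>, so the bound is linear in \<open>card W\<close> and the costs of successive
  disjoint balls add up.\<close>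

lemma (in graph) ex_small_odd_cycle_transversal:
  assumes m: "m \<ge> 1" "m \<le> n" "2 * m \<le> k"
    and girth: "\<And>c. cycle c \<Longrightarrow> odd (length c) \<Longrightarrow> length c > 2 * k + 1"
    and "W \<subseteq> verts G" "card W \<le> n"
  shows "\<exists>X \<subseteq> W. real (card X) \<le> ln (real n / real m) / real m * real (card W) \<and>
    (\<exists>f :: 'a \<Rightarrow> bool. \<forall>e \<in> arcs G. tail G e \<in> W - X \<longrightarrow> head G e \<in> W - X \<longrightarrow>
       f (tail G e) \<noteq> f (head G e))"
  using assms(5,6)
proof (induction "card W" arbitrary: W rule: less_induct)
  case less
  define L where "L = ln (real n / real m) / real m"
  have finW: "finite W" using less.prems finite_subset finite_verts by blast
  show ?case
  proof (cases "W = {}")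
    case True
    then show ?thesis by auto
  next
    case False
    then obtain v where v: "v \<in> W" by auto
    let ?B = "ball_in W v"
    have BW: "?B r \<subseteq> W" for r using ball_in_subset[OF v] .
    have finB: "finite (?B r)" for r using BW finW finite_subset by blast
    have cardB: "card (?B r) \<le> n" for r
      using card_mono[OF finW BW] less.prems(2) le_trans by blast
    have B0: "?B 0 \<noteq> {}" and Bmono: "?B i \<subseteq> ?B (Suc i)" for i by auto
    \<comment> \<open>The sphere is charged to the outer ball \<open>?B (Suc r)\<close>, which is
      exactly what leaves \<open>W\<close>.\<close>
    obtain r where r: "r < 2 * m"
      "real (card (?B (Suc r) - ?B r)) \<le> L * real (card (?B (Suc r)))"
      using small_sphere_exists[where B = ?B, OF m(1,2) finB B0 Bmono cardB] unfolding L_def by blast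
    let ?S = "?B (Suc r) - ?B r" and ?W' = "W - ?B (Suc r)"
    have "v \<in> ?B i" for i by (induction i) auto
    then have "?W' \<subset> W" using v by blast
    then have less': "card ?W' < card W" using finW psubset_card_mono by blast
    have W': "?W' \<subseteq> verts G" "card ?W' \<le> n" using less.prems less' by auto
    obtain X' f' where X': "X' \<subseteq> ?W'" "real (card X') \<le> L * real (card ?W')"
      and f': "\<forall>e \<in> arcs G. tail G e \<in> ?W' - X' \<longrightarrow> head G e \<in> ?W' - X' \<longrightarrow>
         f' (tail G e) \<noteq> (f' (head G e) :: bool)"
      using less.hyps[OF less' W'] unfolding L_def by (elim exE conjE)
    let ?X = "?S \<union> X'"
    \<comment> \<open>The two colourings may be glued without adjustment, because deleting
      \<open>?S\<close> leaves no arc between the inner ball and \<open>?W'\<close>.\<close>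
    define f where "f w = (if w \<in> ?B r then even (level_in W v w) else f' w)" for w
    have "card ?W' + card (?B (Suc r)) = card W"
      using card_Diff_subset[OF finB BW] card_mono[OF finW BW] by (metis le_add_diff_inverse2)
    then have cW: "real (card W) = real (card ?W') + real (card (?B (Suc r)))" by linarith
    have "real (card ?X) \<le> real (card ?S) + real (card X')"
      using card_Un_le[of ?S X'] by linarith
    also have "\<dots> \<le> L * real (card (?B (Suc r))) + L * real (card ?W')"
      using r X' by linarith
    also have "\<dots> = L * real (card W)" by (simp add: cW algebra_simps)
    finally have cX: "real (card ?X) \<le> L * real (card W)" .
    have "f (tail G e) \<noteq> f (head G e)"
      if e: "e \<in> arcs G" "tail G e \<in> W - ?X" "head G e \<in> W - ?X" for e
    proof -
      obtain e' where e': "e' \<in> arcs G" "tail G e' = head G e" "head G e' = tail G e"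
        using ex_reverse_arc[OF e(1)] .
      have same: "tail G e \<in> ?B r \<longleftrightarrow> head G e \<in> ?B r"
      proof
        assume "tail G e \<in> ?B r"
        then have "head G e \<in> ?B (Suc r)" using e by auto
        then show "head G e \<in> ?B r" using e by blast
      next
        assume "head G e \<in> ?B r"
        then have "tail G e \<in> ?B (Suc r)" using e e' by auto
        then show "tail G e \<in> ?B r" using e by blast
      qed
      show ?thesis
      proof (cases "tail G e \<in> ?B r")
        case True
        \<comment> \<open>Here \<open>r < 2 * m \<le> k\<close>, so the hypothesis on odd cycles
          covers the whole ball.\<close>
        have "length c > 2 * r + 1" if "cycle c" "odd (length c)" for c
          using girth[OF that] r m by linarith
        from level_in_parity_alternates[OF v less.prems(1) this e(1) True] True same
        show ?thesis unfolding f_def by simp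
      next
        case False
        then have "tail G e \<in> ?W' - X'" "head G e \<in> ?W' - X'" using e same by blast+
        with f' e(1) False same show ?thesis unfolding f_def by simp
      qed
    qed
    then have "\<forall>e \<in> arcs G. tail G e \<in> W - ?X \<longrightarrow> head G e \<in> W - ?X \<longrightarrow>
       f (tail G e) \<noteq> f (head G e)" by blast
    moreover have "?X \<subseteq> W" using BW X' by blast
    ultimately show ?thesis using cX unfolding L_def by blast
  qed
qed

theorem theorem1p4:
  fixes G :: "('a, 'b) pre_digraph" and n k :: nat
  assumes "graph G"
    and "card (verts G) = n"
    and "k \<ge> 2"
    and "k div 2 \<le> n"
    and "\<And>p. pre_digraph.cycle G p \<Longrightarrow> odd (length p) \<Longrightarrow> length p > 2 * k + 1"
  shows "\<exists>X \<subseteq> verts G.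
    real (card X) \<le> real n / real (k div 2) * ln (real n / real (k div 2)) \<and>
    bipartite (G \<restriction> (verts G - X))"
proof -
  interpret graph G by fact
  have m: "k div 2 \<ge> 1" "2 * (k div 2) \<le> k" using assms(3) by linarith+
  obtain X f where
    X: "X \<subseteq> verts G" "real (card X) \<le> ln (real n / real (k div 2)) / real (k div 2) * real n"
    and f: "\<forall>e \<in> arcs G. tail G e \<in> verts G - X \<longrightarrow> head G e \<in> verts G - X \<longrightarrow>
       f (tail G e) \<noteq> (f (head G e) :: bool)"
    using ex_small_odd_cycle_transversal[OF m(1) assms(4) m(2) assms(5), of "verts G"] assms(2)
    by auto
  \<comment> \<open>The two colour classes of \<open>f\<close> outside \<open>X\<close> serve as the
    sides.\<close>
  have "bipartite (G \<restriction> (verts G - X))"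
    unfolding bipartite_def
    by (rule exI[of _ "{w \<in> verts G - X. f w}"], rule exI[of _ "{w \<in> verts G - X. \<not> f w}"])
      (use f in auto)
  then show ?thesis using X by (intro exI[of _ X]) (simp add: mult.commute)
qed

end
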